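(* Let $d\geq 3$ be an integer. Any semitoric fan $(v_0,\ldots,v_{d-1})\in(\mathbb{Z}^2)^d$ of defect $c\in\mathbb{Z}_{\geq 0}$ can be transformed, by applying the four fan transformations (corner chop, reverse corner chop, removing a hidden corner, commuting a fake and a Delzant corner) finitely many times, into a semitoric fan which is $\mathcal{G}'$-equivalent to the standard semitoric fan of defect $c$.
   Context: Let $T=\begin{pmatrix}1&1\\0&1\end{pmatrix}$. For $v,w\in\mathbb{Z}^2$, $\det(v,w)$ is the determinant of the matrix with columns $v,w$. An ordered pair $(v,w)$ of vectors in $\mathbb{Z}^2$ is \emph{on the top boundary} if both vectors lie in the open lower half-plane; it satisfies the \emph{Delzant condition} if $\det(v,w)=1$, the \emph{hidden condition} if $\det(v,Tw)=1$, and the \emph{fake condition} if $\det(v,Tw)=0$. A \emph{semitoric fan} ($d>2$) is a collection of primitive vectors $(v_0=v_d,v_1,\ldots,v_{d-1})\in(\mathbb{Z}^2)^d$ labeled in counter-clockwise order (going once around the origin), together with a label ``Delzant'', ``fake'' or ``hidden'' on each adjacent pair (corner) $(v_i,v_{i+1})$, $i=0,\ldots,d-1$, such that each labeled pair satisfies the corresponding condition and all fake and hidden corners are on the top boundary. Indices are cyclic, and fans are considered up to cyclic relabeling. The \emph{defect} of the fan is the number of corners labeled fake or hidden. $\mathcal{G}'=\{T^k : k\in\mathbb{Z}\}$ acts on semitoric fans by acting on each vector; two fans are $\mathcal{G}'$-equivalent if they lie in the same orbit. The \emph{standard semitoric fan of defect $c$} is $(u_0,\ldots,u_{c+3})\in(\mathbb{Z}^2)^{c+4}$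 with $u_0=\binom{0}{-1}$, $u_1=\binom{1}{0}$, $u_2=\binom{c}{1}$, $u_3=\binom{-1}{0}$ and $u_{4+n}=\binom{-c+n}{-1}$ for $n=0,\ldots,c-1$, in which the first four pairs $(u_0,u_1),(u_1,u_2),(u_2,u_3),(u_3,u_4)$ (with $u_4=u_0$ if $c=0$) are Delzant corners and the remaining pairs are fake corners. The \emph{four fan transformations} of a semitoric fan $(v_0,\ldots,v_{d-1})$ are (labels of corners not mentioned are unchanged): (a) \emph{Corner chop}: if $(v_i,v_{i+1})$ is a Delzant corner, replace the fan by $(v_0,\ldots,v_i,v_i+v_{i+1},v_{i+1},\ldots,v_{d-1})$, with both new pairs labeled Delzant. (b) \emph{Reverse corner chop}: if $(v_{i-1},v_i)$ and $(v_i,v_{i+1})$ are Delzant corners and $v_i=v_{i-1}+v_{i+1}$, replace the fan by $(v_0,\ldots,v_{i-1},v_{i+1},\ldots,v_{d-1})$, with $(v_{i-1},v_{i+1})$ labeled Delzant. (c) \emph{Removing a hidden corner}: if $(v_i,v_{i+1})$ is a hidden corner, replace the fan by $(v_0,\ldots,v_i,Tv_{i+1},v_{i+1},\ldots,v_{d-1})$, with $(v_i,Tv_{i+1})$ labeled Delzant and $(Tv_{i+1},v_{i+1})$ labeled fake. (d) \emph{Commuting a fake and a Delzant corner}: if $(v_i,v_{i+1})$ is a fake corner and $(v_{i+1},v_{i+2})$ is a Delzant corner on the top boundary, replace the fan by $(v_0,\ldots,v_i,Tv_{i+2},v_{i+2},\ldots,v_{d-1})$ (i.e. $v_{i+1}$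 is replaced by $Tv_{i+2}$), with $(v_i,Tv_{i+2})$ labeled Delzant and $(Tv_{i+2},v_{i+2})$ labeled fake. Each of these produces again a semitoric fan. *)

theory Defs
  imports "HOL-Analysis.Analysis"
begin

definition T :: "int^2^2" where
  "T = vector [vector [1, 1], vector [0, 1]]"

text \<open>The integer powers of \<open>T\<close> in closed form; see the lemmas below.\<close>
definition T_pow :: "int \<Rightarrow> int^2^2" where
  "T_pow k = vector [vector [1, k], vector [0, 1]]"

lemma T_pow_0: "T_pow 0 = mat 1"
  by (simp add: T_pow_def mat_def vec_eq_iff forall_2)

lemma T_pow_1: "T_pow 1 = T"
  by (simp add: T_pow_def T_def)

lemma T_pow_add: "T_pow (j + k) = T_pow j ** T_pow k"
  by (simp add: T_pow_def matrix_matrix_mult_def vec_eq_iff forall_2 sum_2)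

definition det_cols :: "int^2 \<Rightarrow> int^2 \<Rightarrow> int" where
  "det_cols v w = det (transpose (vector [v, w] :: int^2^2))"

definition primitive :: "int^2 \<Rightarrow> bool" where
  "primitive v \<longleftrightarrow> coprime (v $ 1) (v $ 2)"

definition on_top_boundary :: "int^2 \<Rightarrow> int^2 \<Rightarrow> bool" where
  "on_top_boundary v w \<longleftrightarrow> v $ 2 < 0 \<and> w $ 2 < 0"

definition delzant_condition :: "int^2 \<Rightarrow> int^2 \<Rightarrow> bool" where
  "delzant_condition v w \<longleftrightarrow> det_cols v w = 1"

definition hidden_condition :: "int^2 \<Rightarrow> int^2 \<Rightarrow> bool" where
  "hidden_condition v w \<longleftrightarrow> det_cols v (T *v w) = 1"

definition fake_condition :: "int^2 \<Rightarrow> int^2 \<Rightarrow> bool" where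
  "fake_condition v w \<longleftrightarrow> det_cols v (T *v w) = 0"

datatype corner_label = Delzant | Fake | Hidden

fun corner_ok :: "corner_label \<Rightarrow> int^2 \<Rightarrow> int^2 \<Rightarrow> bool" where
  "corner_ok Delzant v w \<longleftrightarrow> delzant_condition v w"
| "corner_ok Fake v w \<longleftrightarrow> fake_condition v w \<and> on_top_boundary v w"
| "corner_ok Hidden v w \<longleftrightarrow> hidden_condition v w \<and> on_top_boundary v w"

text \<open>
  A labelled collection is a list whose \<open>i\<close>-th entry consists of the vector \<open>v\<^sub>i\<close> and the
  label of the corner \<open>(v\<^sub>i, v\<^sub>i\<^sub>+\<^sub>1)\<close>; the last entry carries the label of
  \<open>(v\<^sub>d\<^sub>-\<^sub>1, v\<^sub>0)\<close>.
\<close>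
type_synonym labelled_vectors = "((int^2) \<times> corner_label) list"

definition has_angle :: "int^2 \<Rightarrow> real \<Rightarrow> bool" where
  "has_angle v \<theta> \<longleftrightarrow>
     (\<exists>r>0. real_of_int (v $ 1) = r * cos \<theta> \<and> real_of_int (v $ 2) = r * sin \<theta>)"

text \<open>
  Counter-clockwise order, going once around the origin: polar angles can be chosen that
  strictly increase along the list and stay within one full turn of the first angle.
\<close>
definition counterclockwise_once :: "(int^2) list \<Rightarrow> bool" where
  "counterclockwise_once vs \<longleftrightarrow>
     (\<exists>\<theta>s. list_all2 has_angle vs \<theta>s \<and> sorted_wrt (<) \<theta>s \<and> last \<theta>s < hd \<theta>s + 2 * pi)"

definition semitoric_fan :: "labelled_vectors \<Rightarrow> bool" where
  "semitoric_fan F \<longleftrightarrow>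
     length F > 2 \<and>
     (\<forall>i<length F. primitive (fst (F ! i))) \<and>
     counterclockwise_once (map fst F) \<and>
     (\<forall>i<length F. corner_ok (snd (F ! i)) (fst (F ! i)) (fst (F ! (Suc i mod length F))))"

definition defect :: "labelled_vectors \<Rightarrow> nat" where
  "defect F = card {i. i < length F \<and> snd (F ! i) \<in> {Fake, Hidden}}"

definition cyclic_relabelling :: "labelled_vectors \<Rightarrow> labelled_vectors \<Rightarrow> bool" where
  "cyclic_relabelling F G \<longleftrightarrow> (\<exists>k. G = rotate k F)"

definition act :: "int^2^2 \<Rightarrow> labelled_vectors \<Rightarrow> labelled_vectors" where
  "act A F = map (\<lambda>(v, l). (A *v v, l)) F"

text \<open>Fans are considered up to cyclic relabelling.\<close>
definition G'_equivalent :: "labelled_vectors \<Rightarrow> labelled_vectors \<Rightarrow> bool" where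
  "G'_equivalent F G \<longleftrightarrow> (\<exists>k. cyclic_relabelling (act (T_pow k) F) G)"

definition standard_fan :: "nat \<Rightarrow> labelled_vectors" where
  "standard_fan c =
     [(vector [0, -1], Delzant), (vector [1, 0], Delzant),
      (vector [int c, 1], Delzant), (vector [-1, 0], Delzant)]
     @ map (\<lambda>n. (vector [- int c + int n, -1], Fake)) [0..<c]"

text \<open>
  The four fan transformations.  Since fans are considered up to cyclic relabelling, each one
  is stated with the vectors involved at the front of the list, and the last rule lets it be
  applied at any position.  In each rule \<open>l\<close> is the unchanged label of the corner following
  the vectors involved.
\<close>
inductive fan_transformation :: "labelled_vectors \<Rightarrow> labelled_vectors \<Rightarrow> bool" where
  corner_chop:
    "fan_transformation
       ((v, Delzant) # (w, l) # F)
       ((v, Delzant) # (v + w, Delzant) # (w, l) # F)"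
| reverse_corner_chop:
    "v = u + w \<Longrightarrow>
     fan_transformation
       ((u, Delzant) # (v, Delzant) # (w, l) # F)
       ((u, Delzant) # (w, l) # F)"
| remove_hidden_corner:
    "fan_transformation
       ((v, Hidden) # (w, l) # F)
       ((v, Delzant) # (T *v w, Fake) # (w, l) # F)"
| commute_fake_Delzant:
    "on_top_boundary v w \<Longrightarrow>
     fan_transformation
       ((u, Fake) # (v, Delzant) # (w, l) # F)
       ((u, Delzant) # (T *v w, Fake) # (w, l) # F)"
| relabelled:
    "cyclic_relabelling F F' \<Longrightarrow> fan_transformation F' G' \<Longrightarrow> cyclic_relabelling G' G \<Longrightarrow>
     fan_transformation F G"

end

theory Submission
  imports Defs
begin

text \<open>
  The horizontal axis cuts a fan into two half-planes that can be simplified independently.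
  Fake and hidden corners lie in the open lower half-plane, so a corner whose cone contains
  \<open>(1, 0)\<close> or \<open>(-1, 0)\<close> in its interior is a Delzant corner, and corner chops carried out as
  in the Euclidean algorithm make that vector a member of the fan (\<open>corner_subdivision\<close>).
  After this the fan is a closed path \<open>(1, 0), U, (-1, 0), L\<close> with \<open>U\<close> above and \<open>L\<close> below
  the axis (\<open>fan_cut_at_axis\<close>). Polar angles are used only for this and for checking that
  the final fan goes once around the origin; in between, the order of the vectors is
  controlled by determinants.

  Reverse corner chops do the main simplification: a path of Delzant corners that stays
  inside a cone spanned by vectors of determinant \<open>1\<close> can be shortened to the two sides of
  that cone (\<open>unimodular_cone_collapse\<close>), because at a peak of a suitable linear function
  the vector is the sum of its neighbours.

  Above the axis all corners are Delzant. The first vector of \<open>U\<close> has determinant \<open>1\<close> with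
  \<open>(1, 0)\<close>, hence it is \<open>(a, 1)\<close>; the rest of \<open>U\<close> lies in the unimodular cone of \<open>(a, 1)\<close>
  and \<open>(-1, 0)\<close> and collapses, and \<open>a\<close> can be changed by one at a time with a chop followed
  by a reverse chop.

  Below the axis the last vector is \<open>(k, -1)\<close> for the same reason. Hidden corners are
  replaced by a Delzant and a fake one, and fake corners commute with Delzant corners, so
  that all \<open>c\<close> fake corners are moved to the right end of \<open>L\<close> (\<open>sort_defects\<close>). A fake
  corner that ends at \<open>w\<close> starts at \<open>T w\<close>, so these corners form the run
  \<open>(k - c, -1), \<dots>, (k, -1)\<close>, and the Delzant path from \<open>(-1, 0)\<close> to \<open>(k - c, -1)\<close> collapses
  again. Taking \<open>a = c - k\<close> above the axis, \<open>T\<^sup>k\<close> maps the result to the standard fan.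
\<close>

section \<open>Determinants, shears and corners in coordinates\<close>

lemma det_cols_eq: "det_cols v w = v $ 1 * w $ 2 - v $ 2 * w $ 1"
  by (simp add: det_cols_def det_2 transpose_def)

lemma T_mult_nth [simp]: "(T *v w) $ 1 = w $ 1 + w $ 2" "(T *v w) $ 2 = w $ 2"
  by (simp_all add: T_def matrix_vector_mult_def sum_2)

lemma vec2_eq_iff: "(v :: int^2) = w \<longleftrightarrow> v $ 1 = w $ 1 \<and> v $ 2 = w $ 2"
  by (simp add: vec_eq_iff forall_2)

lemma det_cols_T [simp]: "det_cols (T *v v) (T *v w) = det_cols v w"
  by (simp add: det_cols_eq algebra_simps)

text \<open>
  Cramer's rule: \<open>v\<close> and \<open>w\<close> form a basis of the lattice, and determinants are the
  coordinates.
\<close>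
lemma unimodular_coordinates:
  assumes "det_cols v w = 1"
  shows "x $ i = det_cols x w * v $ i + det_cols v x * w $ i"
proof -
  have d: "v $ 1 * w $ 2 - v $ 2 * w $ 1 = 1"
    using assms by (simp add: det_cols_eq)
  have "x $ 1 = det_cols x w * v $ 1 + det_cols v x * w $ 1"
    using d unfolding det_cols_eq by algebra
  moreover have "x $ 2 = det_cols x w * v $ 2 + det_cols v x * w $ 2"
    using d unfolding det_cols_eq by algebra
  ultimately show ?thesis
    using exhaust_2[of i] by auto
qed

text \<open>
  For primitive vectors the fake condition says more than parallelism, namely \<open>v = T w\<close>.
  With this built in, primitivity need not be carried along when a fan is modified.
\<close>
definition strict_corner :: "corner_label \<Rightarrow> int^2 \<Rightarrow> int^2 \<Rightarrow> bool" where
  "strict_corner l v w \<longleftrightarrow> corner_ok l v w \<and> (l = Fake \<longrightarrow> v = T *v w)"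

lemma strict_corner_simps:
  "strict_corner Delzant v w \<longleftrightarrow> det_cols v w = 1"
  "strict_corner Fake v w \<longleftrightarrow> v = T *v w \<and> v $ 2 < 0"
  "strict_corner Hidden v w \<longleftrightarrow> det_cols v (T *v w) = 1 \<and> v $ 2 < 0 \<and> w $ 2 < 0"
  by (auto simp: strict_corner_def delzant_condition_def fake_condition_def
      hidden_condition_def on_top_boundary_def det_cols_eq)

lemma strict_corner_Delzant:
  assumes "strict_corner l v w" "v $ 2 \<ge> 0 \<or> w $ 2 \<ge> 0"
  shows "l = Delzant"
  using assms by (cases l) (auto simp: strict_corner_simps)

text \<open>
  All three kinds of corners span an angle less than \<open>\<pi>\<close>: fake and hidden corners satisfy
  \<open>det (v, T w) = det (v, w) - v\<^sub>2 w\<^sub>2\<close> with \<open>v\<^sub>2 w\<^sub>2 > 0\<close>.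
\<close>
lemma det_cols_pos_of_strict_corner:
  assumes "strict_corner l v w"
  shows "det_cols v w > 0"
proof (cases l)
  case Hidden
  then have "det_cols v w = 1 + v $ 2 * w $ 2" "v $ 2 * w $ 2 > 0"
    using assms by (auto simp: strict_corner_simps det_cols_eq algebra_simps mult_neg_neg)
  then show ?thesis by simp
qed (use assms in \<open>auto simp: strict_corner_simps det_cols_eq algebra_simps mult_neg_neg\<close>)

lemma primitive_parallel_eq:
  assumes "primitive v" "primitive w" "det_cols v w = 0" "v $ 2 < 0" "w $ 2 < 0"
  shows "v = w"
proof -
  have eq: "v $ 1 * w $ 2 = v $ 2 * w $ 1"
    using assms(3) by (simp add: det_cols_eq)
  have "v $ 2 dvd w $ 2"
    using eq assms(1) unfolding primitive_def
    by (metis coprime_commute coprime_dvd_mult_right_iff dvd_triv_left)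
  moreover have "w $ 2 dvd v $ 2"
    using eq assms(2) unfolding primitive_def
    by (metis coprime_commute coprime_dvd_mult_left_iff dvd_triv_right)
  ultimately have "\<bar>v $ 2\<bar> = \<bar>w $ 2\<bar>"
    by (rule zdvd_antisym_abs)
  then have "v $ 2 = w $ 2" using assms(4,5) by simp
  moreover from this have "v $ 1 = w $ 1" using eq assms(5) by simp
  ultimately show ?thesis by (simp add: vec2_eq_iff)
qed

lemma primitive_T: "primitive v \<Longrightarrow> primitive (T *v v)"
  unfolding primitive_def coprime_iff_gcd_eq_1 by (simp add: gcd_add1)

lemma strict_corner_of_corner_ok:
  assumes "corner_ok l v w" "primitive v" "primitive w"
  shows "strict_corner l v w"
  unfolding strict_corner_def using assms
  by (auto simp: fake_condition_def on_top_boundary_def intro!: primitive_parallel_eq primitive_T)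


section \<open>Labelled paths\<close>

text \<open>
  A list \<open>P\<close> of labelled vectors is read as a path that continues to a vector \<open>z\<close>, which is
  where the corner at its last entry ends. An arc of a fan is such a path, \<open>z\<close> being the
  vector that follows the arc, so that arcs can be modified one at a time.
\<close>
fun start :: "labelled_vectors \<Rightarrow> int^2 \<Rightarrow> int^2" where
  "start [] z = z"
| "start ((v, l) # P) z = v"

fun path_ok :: "labelled_vectors \<Rightarrow> int^2 \<Rightarrow> bool" where
  "path_ok [] z \<longleftrightarrow> True"
| "path_ok ((v, l) # P) z \<longleftrightarrow> strict_corner l v (start P z) \<and> path_ok P z"

lemma start_append [simp]: "start (P @ Q) z = start P (start Q z)"
  by (cases P) auto

lemma path_ok_append: "path_ok (P @ Q) z \<longleftrightarrow> path_ok P (start Q z) \<and> path_ok Q z"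
  by (induction P) auto

lemma start_eq_hd: "P \<noteq> [] \<Longrightarrow> start P z = fst (hd P)"
  by (cases P) auto

abbreviation closed_path_ok :: "labelled_vectors \<Rightarrow> bool" where
  "closed_path_ok F \<equiv> path_ok F (fst (hd F))"

lemma closed_path_ok_append_commute: "closed_path_ok (A @ B) \<longleftrightarrow> closed_path_ok (B @ A)"
  by (cases "A = []"; cases "B = []") (auto simp: path_ok_append start_eq_hd)

lemma path_ok_iff_nth:
  "path_ok P z \<longleftrightarrow>
     (\<forall>i<length P. strict_corner (snd (P ! i)) (fst (P ! i))
        (if Suc i < length P then fst (P ! Suc i) else z))"
proof (induction P)
  case (Cons a P)
  obtain v l where a: "a = (v, l)" by force
  have "start P z = (if P \<noteq> [] then fst (P ! 0) else z)"
    by (cases P) auto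
  then show ?case
    unfolding a using Cons.IH by (auto simp: All_less_Suc2 simp del: One_nat_def)
qed simp

lemma closed_path_ok_iff_nth:
  "closed_path_ok F \<longleftrightarrow>
     (\<forall>i<length F. strict_corner (snd (F ! i)) (fst (F ! i)) (fst (F ! (Suc i mod length F))))"
proof -
  have "(if Suc i < length F then fst (F ! Suc i) else fst (hd F)) = fst (F ! (Suc i mod length F))"
    if "i < length F" for i
  proof (cases "Suc i < length F")
    case False
    then have "Suc i = length F" using that by simp
    then show ?thesis by (cases F) auto
  qed simp
  then show ?thesis by (auto simp: path_ok_iff_nth)
qed

definition with_label :: "corner_label \<Rightarrow> (int^2) list \<Rightarrow> labelled_vectors" where
  "with_label l vs = map (\<lambda>v. (v, l)) vs"

lemma with_label_simps [simp]:
  "with_label l [] = []"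
  "with_label l (v # vs) = (v, l) # with_label l vs"
  "with_label l (vs @ ws) = with_label l vs @ with_label l ws"
  by (simp_all add: with_label_def)

abbreviation delz :: "(int^2) list \<Rightarrow> labelled_vectors" where
  "delz \<equiv> with_label Delzant"

lemma start_with_label: "start (with_label l vs) z = hd (vs @ [z])"
  by (cases vs) auto

lemma set_with_label [simp]: "set (with_label l vs) = (\<lambda>v. (v, l)) ` set vs"
  by (simp add: with_label_def)

lemma path_ok_delz: "path_ok (delz vs) z \<longleftrightarrow> successively (\<lambda>v w. det_cols v w = 1) (vs @ [z])"
proof (induction vs)
  case (Cons v vs)
  then show ?case
    by (cases vs) (auto simp: strict_corner_simps)
qed simp

definition defects :: "labelled_vectors \<Rightarrow> nat" where
  "defects F = length (filter (\<lambda>x. snd x \<noteq> Delzant) F)"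

lemma defects_simps [simp]:
  "defects [] = 0"
  "defects ((v, l) # F) = (if l = Delzant then 0 else 1) + defects F"
  "defects (F @ G) = defects F + defects G"
  "defects (delz vs) = 0"
  by (simp_all add: defects_def with_label_def)

lemma defect_eq_defects: "defect F = defects F"
proof -
  have "l \<in> {Fake, Hidden} \<longleftrightarrow> l \<noteq> Delzant" for l by (cases l) auto
  then show ?thesis unfolding defect_def defects_def length_filter_conv_card by simp
qed


section \<open>Transformations of a part of a fan\<close>

lemma cyclic_relabelling_append: "cyclic_relabelling (A @ B) (B @ A)"
  unfolding cyclic_relabelling_def by (metis rotate_append)

text \<open>
  A change of one arc that is possible in every fan containing it, irrespective of what
  stands around it and of the label \<open>l\<close> of the corner at the endpoint \<open>z\<close>.
\<close>
definition path_moves :: "int^2 \<Rightarrow> labelled_vectors \<Rightarrow> labelled_vectors \<Rightarrow> bool" where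
  "path_moves z P P' \<longleftrightarrow>
     (\<forall>A l B. fan_transformation\<^sup>*\<^sup>* (A @ P @ (z, l) # B) (A @ P' @ (z, l) # B))"

lemma path_moves_refl [simp]: "path_moves z P P"
  by (simp add: path_moves_def)

lemma path_moves_trans [trans]: "path_moves z P Q \<Longrightarrow> path_moves z Q R \<Longrightarrow> path_moves z P R"
  unfolding path_moves_def by (meson rtranclp_trans)

lemma path_moves_context:
  assumes "path_moves (start S z) P P'"
  shows "path_moves z (R @ P @ S) (R @ P' @ S)"
  unfolding path_moves_def
proof (intro allI)
  fix A l B
  obtain l' B' where "S @ (z, l) # B = (start S z, l') # B'"
    by (cases S) auto
  then show "fan_transformation\<^sup>*\<^sup>* (A @ (R @ P @ S) @ (z, l) # B) (A @ (R @ P' @ S) @ (z, l) # B)"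
    using assms[unfolded path_moves_def, rule_format, of "A @ R" l' B'] by simp
qed

text \<open>
  Relabelling brings any arc to the front of the list, where the transformations apply, and
  back.
\<close>
lemma path_moves_step:
  assumes "\<And>l B. fan_transformation (P @ (z, l) # B) (P' @ (z, l) # B)"
  shows "path_moves z P P'"
  unfolding path_moves_def
proof (intro allI r_into_rtranclp)
  fix A l B
  have "fan_transformation (P @ (z, l) # B @ A) (P' @ (z, l) # B @ A)"
    by (rule assms)
  then show "fan_transformation (A @ P @ (z, l) # B) (A @ P' @ (z, l) # B)"
    using relabelled cyclic_relabelling_append[of A "P @ (z, l) # B"]
      cyclic_relabelling_append[of "P' @ (z, l) # B" A] by simp
qed

lemma path_moves_chop: "path_moves w (delz [v]) (delz [v, v + w])"
  by (rule path_moves_step) (simp add: corner_chop)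

lemma path_moves_reverse_chop: "v = u + w \<Longrightarrow> path_moves w (delz [u, v]) (delz [u])"
  by (rule path_moves_step) (simp add: reverse_corner_chop)

lemma path_moves_hidden: "path_moves w [(v, Hidden)] [(v, Delzant), (T *v w, Fake)]"
  by (rule path_moves_step) (simp add: remove_hidden_corner)

lemma path_moves_commute:
  "v $ 2 < 0 \<Longrightarrow> w $ 2 < 0 \<Longrightarrow>
   path_moves w [(u, Fake), (v, Delzant)] [(u, Delzant), (T *v w, Fake)]"
  by (rule path_moves_step) (simp add: commute_fake_Delzant on_top_boundary_def)

text \<open>
  No transformation is available for a mere relabelling, so rotations have to be allowed
  explicitly after the transformations.
\<close>
definition leads_to :: "labelled_vectors \<Rightarrow> labelled_vectors \<Rightarrow> bool" where
  "leads_to F G \<longleftrightarrow> (\<exists>H. fan_transformation\<^sup>*\<^sup>* F H \<and> cyclic_relabelling H G)"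

lemma cyclic_relabelling_refl: "cyclic_relabelling F F"
  unfolding cyclic_relabelling_def by (metis rotate0 id_apply)

lemma cyclic_relabelling_trans:
  "cyclic_relabelling F G \<Longrightarrow> cyclic_relabelling G H \<Longrightarrow> cyclic_relabelling F H"
  unfolding cyclic_relabelling_def by (auto simp: rotate_rotate)

text \<open>
  A rotation can be absorbed into the last transformation, if there is one.
\<close>
lemma leads_to_cases:
  assumes "leads_to F G"
  shows "cyclic_relabelling F G \<or> fan_transformation\<^sup>*\<^sup>* F G"
proof -
  obtain H where H: "fan_transformation\<^sup>*\<^sup>* F H" "cyclic_relabelling H G"
    using assms unfolding leads_to_def by blast
  from H(1) show ?thesis
  proof (cases rule: rtranclp.cases)
    case (rtrancl_into_rtrancl K)
    then show ?thesis
      using relabelled[OF cyclic_relabelling_refl _ H(2)] by (meson rtranclp.rtrancl_into_rtrancl)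
  qed (use H in auto)
qed

lemma leads_to_relabel: "cyclic_relabelling F G \<Longrightarrow> leads_to F G"
  unfolding leads_to_def by blast

lemma leads_to_transform: "fan_transformation\<^sup>*\<^sup>* F G \<Longrightarrow> leads_to F G"
  unfolding leads_to_def using cyclic_relabelling_refl by blast

lemma leads_to_trans [trans]:
  assumes "leads_to F G" "leads_to G K"
  shows "leads_to F K"
  using leads_to_cases[OF assms(1)]
proof
  assume FG: "cyclic_relabelling F G"
  obtain H where H: "fan_transformation\<^sup>*\<^sup>* G H" "cyclic_relabelling H K"
    using assms(2) unfolding leads_to_def by blast
  from H(1) show ?thesis
  proof (cases rule: converse_rtranclpE)
    case base
    then show ?thesis using FG H(2) cyclic_relabelling_trans leads_to_relabel by blast
  next
    case (step G')
    then have "fan_transformation\<^sup>*\<^sup>* F H"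
      using relabelled[OF FG _ cyclic_relabelling_refl] by (meson converse_rtranclp_into_rtranclp)
    then show ?thesis unfolding leads_to_def using H(2) by blast
  qed
next
  assume "fan_transformation\<^sup>*\<^sup>* F G"
  then show ?thesis using assms(2) unfolding leads_to_def by (meson rtranclp_trans)
qed

text \<open>
  The arc \<open>P @ B\<close> closes up at the head of \<open>A\<close>, which is why \<open>A\<close> must be nonempty.
\<close>
lemma leads_to_path_moves:
  assumes "path_moves (start B (fst (hd A))) P P'" "A \<noteq> []"
  shows "leads_to (A @ P @ B) (A @ P' @ B)"
proof -
  obtain z l A' where A: "A = (z, l) # A'" using assms(2) by (cases A) auto
  have "leads_to (A @ P @ B) (P @ B @ A)"
    using leads_to_relabel[OF cyclic_relabelling_append[of A "P @ B"]] by simp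
  also have "leads_to \<dots> (P' @ B @ A)"
    using path_moves_context[of B z P P' "[]"] assms(1) leads_to_transform
    unfolding A path_moves_def by (metis append.assoc append_Nil fst_conv list.sel(1))
  also have "leads_to \<dots> (A @ P' @ B)"
    using leads_to_relabel[OF cyclic_relabelling_append[of "P' @ B" A]] by simp
  finally show ?thesis .
qed


section \<open>Subdividing and collapsing unimodular cones\<close>

lemma det_cols_add: "det_cols (u + v) w = det_cols u w + det_cols v w"
  "det_cols u (v + w) = det_cols u v + det_cols u w"
  by (simp_all add: det_cols_eq algebra_simps)

lemma det_cols_self [simp]: "det_cols v v = 0"
  by (simp add: det_cols_eq)

lemma det_cols_swap: "det_cols w v = - det_cols v w"
  by (simp add: det_cols_eq)

text \<open>
  The subtractive Euclidean algorithm on the coordinates \<open>(a, b)\<close> of \<open>x\<close> with respect to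
  \<open>v, w\<close>: after chopping, \<open>x\<close> is \<open>v + w\<close> or has coordinates \<open>(a - b, b)\<close> in the cone of
  \<open>v, v + w\<close> or \<open>(a, b - a)\<close> in the cone of \<open>v + w, w\<close>. The two sign conditions record on
  which side of \<open>x\<close> the new vectors lie; for \<open>x\<close> on the horizontal axis they say in which
  half-plane.
\<close>
lemma corner_subdivision:
  assumes "det_cols v w = 1" "det_cols v x > 0" "det_cols x w > 0"
    and "coprime (det_cols x w) (det_cols v x)"
  shows "\<exists>ps qs. path_moves w (delz [v]) (delz (v # ps @ x # qs)) \<and>
           path_ok (delz (v # ps @ x # qs)) w \<and>
           (\<forall>p\<in>set ps. det_cols p x > 0) \<and> (\<forall>q\<in>set qs. det_cols x q > 0)"
  using assms
proof (induction "nat (det_cols x w + det_cols v x)" arbitrary: v w rule: less_induct)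
  case less
  note d = less.prems
  let ?m = "v + w"
  have m: "det_cols v ?m = 1" "det_cols ?m w = 1"
    "det_cols x ?m = det_cols x w - det_cols v x" "det_cols ?m x = det_cols v x - det_cols x w"
    using d(1) by (simp_all add: det_cols_add det_cols_swap[of x])
  consider "det_cols x w = det_cols v x" | "det_cols x w > det_cols v x" | "det_cols x w < det_cols v x"
    by linarith
  then show ?case
  proof cases
    case 1
    then have "det_cols v x = 1" "det_cols x w = 1" using d by auto
    then have "x = ?m"
      using unimodular_coordinates[OF d(1), of x] by (simp add: vec2_eq_iff)
    then have "path_moves w (delz [v]) (delz (v # [] @ x # []))"
      using path_moves_chop[of w v] by simp
    then show ?thesis
      using m \<open>x = ?m\<close> by (intro exI[of _ "[]"]) (auto simp: strict_corner_simps)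
  next
    case 2
    have "coprime (det_cols x w - det_cols v x) (det_cols v x)"
      using d(4) by (metis coprime_iff_gcd_eq_1 gcd_diff1)
    then obtain ps qs where IH:
      "path_moves ?m (delz [v]) (delz (v # ps @ x # qs))" "path_ok (delz (v # ps @ x # qs)) ?m"
      "\<forall>p\<in>set ps. det_cols p x > 0" "\<forall>q\<in>set qs. det_cols x q > 0"
      using less.hyps[of ?m v] 2 d m by auto
    have "path_moves w (delz [v]) (delz [v] @ delz [?m])"
      using path_moves_chop[of w v] by simp
    also have "path_moves w \<dots> (delz (v # ps @ x # qs) @ delz [?m])"
      using path_moves_context[of "delz [?m]" w "delz [v]" "delz (v # ps @ x # qs)" "[]"] IH(1) by simp
    finally have "path_moves w (delz [v]) (delz (v # ps @ x # (qs @ [?m])))"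
      by simp
    moreover have "path_ok (delz (v # ps @ x # qs) @ delz [?m]) w"
      unfolding path_ok_append using IH(2) m by (simp add: strict_corner_simps)
    then have "path_ok (delz (v # ps @ x # (qs @ [?m]))) w" by simp
    moreover have "\<forall>q\<in>set (qs @ [?m]). det_cols x q > 0"
      using IH(4) 2 m by auto
    ultimately show ?thesis using IH(3) by blast
  next
    case 3
    have "coprime (det_cols x w) (det_cols v x - det_cols x w)"
      using d(4) by (metis coprime_iff_gcd_eq_1 gcd_diff1 gcd.commute)
    then obtain ps qs where IH:
      "path_moves w (delz [?m]) (delz (?m # ps @ x # qs))" "path_ok (delz (?m # ps @ x # qs)) w"
      "\<forall>p\<in>set ps. det_cols p x > 0" "\<forall>q\<in>set qs. det_cols x q > 0"
      using less.hyps[of w ?m] 3 d m by auto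
    have "path_moves w (delz [v]) (delz [v] @ delz [?m])"
      using path_moves_chop[of w v] by simp
    also have "path_moves w \<dots> (delz [v] @ delz (?m # ps @ x # qs))"
      using path_moves_context[of "[]" w "delz [?m]" "delz (?m # ps @ x # qs)" "delz [v]"] IH(1) by simp
    finally have "path_moves w (delz [v]) (delz (v # (?m # ps) @ x # qs))"
      by simp
    moreover have "path_ok (delz (v # (?m # ps) @ x # qs)) w"
      using IH(2) m by (simp add: strict_corner_simps)
    moreover have "\<forall>p\<in>set (?m # ps). det_cols p x > 0"
      using IH(3) 3 m by auto
    ultimately show ?thesis using IH(4) by blast
  qed
qed

lemma coprime_unimodular_coordinates:
  assumes "det_cols v w = 1" "primitive x"
  shows "coprime (det_cols x w) (det_cols v x)"
proof (rule coprimeI)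
  fix g assume "g dvd det_cols x w" "g dvd det_cols v x"
  then have "g dvd x $ i" for i
    using unimodular_coordinates[OF assms(1), of x i] by simp
  then show "is_unit g"
    using assms(2) unfolding primitive_def by (meson coprime_common_divisor)
qed

text \<open>
  Climb from \<open>x\<close> for as long as the values increase; the last value is too low to be the
  top.
\<close>
lemma list_has_peak:
  fixes f :: "'a \<Rightarrow> int"
  assumes "f x < f y" "f (last (y # zs)) < f y"
  shows "\<exists>A a b c B. x # y # zs = A @ a # b # c # B \<and> f a < f b \<and> f c \<le> f b"
  using assms
proof (induction zs arbitrary: x y)
  case (Cons z zs)
  show ?case
  proof (cases "f z \<le> f y")
    case True
    then have "x # y # z # zs = [] @ x # y # z # zs \<and> f x < f y \<and> f z \<le> f y"
      using Cons.prems by simp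
    then show ?thesis by blast
  next
    case False
    then have "f y < f z" "f (last (z # zs)) < f z" using Cons.prems by auto
    then obtain A a b c B where "y # z # zs = A @ a # b # c # B" "f a < f b" "f c \<le> f b"
      using Cons.IH by blast
    then show ?thesis by (metis append_Cons)
  qed
qed simp

text \<open>
  Both \<open>a, b\<close> and \<open>b, c\<close> are lattice bases, so \<open>a + c = k b\<close> for an integer \<open>k\<close>. As \<open>f\<close> is
  positive at \<open>a\<close> and \<open>c\<close> and has a peak at \<open>b\<close>, it follows that \<open>0 < k < 2\<close>.
\<close>
lemma unimodular_peak_is_sum:
  assumes "det_cols a b = 1" "det_cols b c = 1"
    and lin: "f = (\<lambda>p. m * p $ 1 + n * p $ 2)"
    and "0 < f a" "0 < f c" "f a < f b" "f c \<le> f b"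
  shows "b = a + c"
proof -
  define k where "k = det_cols a c"
  have c: "c $ i = k * b $ i - a $ i" for i
    using unimodular_coordinates[OF assms(1), of c i] assms(2)
    by (simp add: k_def det_cols_swap[of c])
  have "f a + f c = k * f b"
    unfolding lin c by (simp add: algebra_simps)
  then have "0 < k * f b" "k * f b < 2 * f b" "0 < f b"
    using assms(4-7) by linarith+
  then have "0 < k" "k < 2"
    by (simp_all add: zero_less_mult_iff)
  then have "k = 1" by simp
  then show ?thesis using c by (simp add: vec2_eq_iff)
qed

text \<open>
  The sum \<open>f\<close> of the two coordinates is \<open>1\<close> at \<open>v\<close> and \<open>w\<close> and at least \<open>2\<close> at the lattice
  points inside the cone, so it has a peak among the inner vectors of the path. That vector
  is the sum of its neighbours and a reverse chop removes it.
\<close>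
lemma unimodular_cone_collapse:
  assumes "path_ok (delz (v # ps)) w" "det_cols v w = 1"
    and "\<forall>p\<in>set ps. det_cols v p > 0 \<and> det_cols p w > 0"
  shows "path_moves w (delz (v # ps)) (delz [v])"
  using assms
proof (induction "length ps" arbitrary: ps rule: less_induct)
  case less
  show ?case
  proof (cases ps)
    case (Cons p ps')
    define f where "f q = det_cols v q + det_cols q w" for q
    \<comment> \<open>\<open>f\<close> as a linear form in the entries of \<open>q\<close>\<close>
    have f_lin: "f = (\<lambda>q. (w $ 2 - v $ 2) * q $ 1 + (v $ 1 - w $ 1) * q $ 2)"
      unfolding f_def det_cols_eq by (simp add: fun_eq_iff algebra_simps)
    have f_ends: "f v = 1" "f w = 1" using less.prems(2) by (auto simp: f_def)
    have f_pos: "f q > 0" if "q \<in> set (v # ps @ [w])" for q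
      using that less.prems(3) f_ends by (auto simp: f_def)
    have "f p > 1" using less.prems(3) Cons by (force simp: f_def)
    then obtain A a b c B where abc: "v # p # ps' @ [w] = A @ a # b # c # B"
      and peak: "f a < f b" "f c \<le> f b"
      using list_has_peak[of f v p "ps' @ [w]"] f_ends by auto
    have list: "v # ps @ [w] = A @ a # b # c # B" using abc Cons by simp
    have succ: "successively (\<lambda>v w. det_cols v w = 1) (A @ a # b # c # B)"
      using less.prems(1) list unfolding path_ok_delz by simp
    then have det: "det_cols a b = 1" "det_cols b c = 1"
      by (auto simp: successively_append_iff)
    have "a \<in> set (v # ps @ [w])" "c \<in> set (v # ps @ [w])" unfolding list by auto
    then have b: "b = a + c"
      using unimodular_peak_is_sum[OF det f_lin] f_pos peak by blast
    \<comment> \<open>\<open>b\<close> is neither the first nor the last vector, so it can be removed from \<open>ps\<close>.\<close>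
    obtain A' where A': "A @ [a] = v # A'" using list by (cases A) auto
    obtain B' where B': "c # B = B' @ [w]"
      using list by (metis append_butlast_last_id last.simps last_appendR list.distinct(1)
          snoc_eq_iff_butlast)
    have "v # ps @ [w] = (A @ [a]) @ [b] @ (c # B)" using list by simp
    then have ps: "ps = A' @ b # B'" unfolding A' B' by simp
    have hd_B': "start (delz B') w = c" using B' by (cases B') auto
    have "path_moves w (delz A @ delz [a, b] @ delz B') (delz A @ delz [a] @ delz B')"
      by (intro path_moves_context) (simp only: hd_B' path_moves_reverse_chop[OF b])
    moreover have "delz A @ delz [a, b] @ delz B' = delz (v # ps)"
      using A' ps by (metis Cons_eq_appendI append.assoc append_Cons append_Nil with_label_simps(3))
    moreover have "delz A @ delz [a] @ delz B' = delz (v # A' @ B')"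
      using A' by (metis append.assoc append_Cons with_label_simps(3))
    ultimately have 1: "path_moves w (delz (v # ps)) (delz (v # A' @ B'))" by (simp only:)
    have "det_cols a c = 1" using det b by (simp add: det_cols_add)
    then have "successively (\<lambda>v w. det_cols v w = 1) (A @ a # c # B)"
      using succ by (auto simp: successively_append_iff)
    moreover have "A @ a # c # B = (v # A' @ B') @ [w]"
      using A' B' by (metis append.assoc append_Cons append_Nil)
    ultimately have "path_ok (delz (v # A' @ B')) w" unfolding path_ok_delz by simp
    then have "path_moves w (delz (v # A' @ B')) (delz [v])"
      using less.hyps[of "A' @ B'"] less.prems ps by simp
    with 1 show ?thesis by (rule path_moves_trans)
  qed simp
qed

text \<open>
  In the half-plane \<open>s y > 0\<close>, positivity of the determinant is transitive, because
  \<open>y\<^sub>2 det (x, z) = x\<^sub>2 det (y, z) + z\<^sub>2 det (x, y)\<close>.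
\<close>
lemma half_plane_chain_sorted:
  fixes s :: int
  assumes "\<forall>p\<in>set xs. s * p $ 2 > 0" "successively (\<lambda>v w. det_cols v w = 1) xs"
  shows "sorted_wrt (\<lambda>v w. det_cols v w > 0) xs"
proof -
  have "successively (\<lambda>v w. det_cols v w > 0) xs"
    by (rule successively_mono[OF assms(2)]) simp
  moreover have "det_cols x z > 0"
    if "x \<in> set xs" "y \<in> set xs" "z \<in> set xs" "det_cols x y > 0" "det_cols y z > 0" for x y z
  proof -
    have "(s * y $ 2) * det_cols x z = (s * x $ 2) * det_cols y z + (s * z $ 2) * det_cols x y"
      by (simp add: det_cols_eq algebra_simps)
    also have "\<dots> > 0" using assms(1) that by (simp add: add_pos_pos)
    finally show ?thesis using assms(1) that(2) zero_less_mult_pos by blast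
  qed
  ultimately show ?thesis
    by (subst (asm) successively_iff_sorted_wrt_strong) blast+
qed


section \<open>Moving the defects of the lower half-plane\<close>

text \<open>
  A fake corner starts at \<open>u = T v\<close>, where \<open>v\<close> is the vector at which it ends. Commuting it
  past the Delzant corner \<open>(v, v')\<close> replaces \<open>v\<close> by \<open>T v'\<close> and leaves a fake corner starting
  there, so pushing it through a whole path amounts to applying \<open>T\<close> to the path.
\<close>
lemma push_fake:
  assumes "u = T *v hd (vs @ [w])" "\<forall>v\<in>set vs. v $ 2 < 0" "w $ 2 < 0"
  shows "path_moves w ((u, Fake) # delz vs) (delz (map ((*v) T) vs) @ [(T *v w, Fake)])"
  using assms
proof (induction vs arbitrary: u)
  case (Cons v vs)
  let ?w = "hd (vs @ [w])"
  have "?w $ 2 < 0" using Cons.prems by (cases vs) auto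
  then have "path_moves w ([] @ [(u, Fake), (v, Delzant)] @ delz vs)
     ([] @ [(u, Delzant), (T *v ?w, Fake)] @ delz vs)"
    using Cons.prems by (intro path_moves_context) (simp add: start_with_label path_moves_commute)
  then have "path_moves w ((u, Fake) # delz (v # vs)) ([(u, Delzant)] @ ((T *v ?w, Fake) # delz vs) @ [])"
    by simp
  also have "path_moves w \<dots> ([(u, Delzant)] @ (delz (map ((*v) T) vs) @ [(T *v w, Fake)]) @ [])"
    using Cons by (intro path_moves_context) simp
  finally show ?case using Cons.prems by simp
qed simp

lemma push_fake_path_ok:
  assumes "path_ok (delz vs) w" "w $ 2 < 0"
  shows "path_ok (delz (map ((*v) T) vs) @ [(T *v w, Fake)]) w"
proof -
  have "path_ok (delz (map ((*v) T) vs)) (T *v w)"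
    using assms(1)
  proof (induction vs)
    case (Cons v vs)
    then show ?case by (cases vs) (auto simp: strict_corner_simps)
  qed simp
  then show ?thesis using assms(2) by (simp add: path_ok_append strict_corner_simps)
qed

text \<open>
  By induction from the right: a fake corner in front of an already sorted path is pushed
  through the Delzant part, and a hidden corner first becomes a Delzant and a fake one. The
  first vector never changes, which keeps the corner leading into the path intact.
\<close>
lemma sort_defects:
  assumes "path_ok P z" "\<forall>x\<in>set P. fst x $ 2 < 0" "z $ 2 < 0"
  shows "\<exists>vs fs. path_moves z P (delz vs @ with_label Fake fs) \<and>
           path_ok (delz vs @ with_label Fake fs) z \<and>
           (\<forall>v\<in>set (vs @ fs). v $ 2 < 0) \<and>
           hd (vs @ fs @ [z]) = start P z \<and> length fs = defects P"
  using assms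
proof (induction P)
  case Nil
  show ?case by (intro exI[of _ "[]"]) simp
next
  case (Cons x P)
  obtain v l where x: "x = (v, l)" by force
  from Cons obtain vs fs where IH:
    "path_moves z P (delz vs @ with_label Fake fs)" "path_ok (delz vs @ with_label Fake fs) z"
    "\<forall>v\<in>set (vs @ fs). v $ 2 < 0" "hd (vs @ fs @ [z]) = start P z" "length fs = defects P"
    unfolding x by auto
  let ?y = "hd (fs @ [z])" and ?fs = "with_label Fake fs"
  have corner: "strict_corner l v (hd (vs @ fs @ [z]))"
    using Cons.prems(1) IH(4) unfolding x by simp
  have y: "hd (vs @ [?y]) = hd (vs @ fs @ [z])" "start ?fs z = ?y"
    by (cases vs; simp) (simp add: start_with_label)
  have low: "\<forall>v\<in>set vs. v $ 2 < 0" "?y $ 2 < 0" "hd (vs @ fs @ [z]) $ 2 < 0" "v $ 2 < 0"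
    using IH(3) Cons.prems(2,3) x by (cases fs; cases vs; auto)+
  have ok: "path_ok (delz vs) ?y" "path_ok ?fs z"
    using IH(2) unfolding path_ok_append y by auto
  have 1: "path_moves z (x # P) ((v, l) # delz vs @ ?fs)"
    using path_moves_context[of "[]" z P "delz vs @ ?fs" "[x]"] IH(1) x by simp
  \<comment> \<open>Common to fake and hidden corners: a fake corner in front of the sorted rest moves to
      the start of the fake part.\<close>
  have pushed: "path_moves z ((u, Fake) # delz vs @ ?fs)
      (delz (map ((*v) T) vs) @ with_label Fake ((T *v ?y) # fs))"
      "path_ok (delz (map ((*v) T) vs) @ with_label Fake ((T *v ?y) # fs)) z"
    if u: "u = T *v hd (vs @ [?y])" for u
  proof -
    show "path_moves z ((u, Fake) # delz vs @ ?fs)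
      (delz (map ((*v) T) vs) @ with_label Fake ((T *v ?y) # fs))"
      using path_moves_context[of ?fs z "(u, Fake) # delz vs"
          "delz (map ((*v) T) vs) @ [(T *v ?y, Fake)]" "[]"] push_fake[OF u low(1,2)] y
      by simp
    show "path_ok (delz (map ((*v) T) vs) @ with_label Fake ((T *v ?y) # fs)) z"
      using push_fake_path_ok[OF ok(1) low(2)] ok(2) y by (simp add: path_ok_append)
  qed
  have low': "\<forall>v\<in>set (map ((*v) T) vs @ (T *v ?y) # fs). v $ 2 < 0"
    using low IH(3) by auto
  have hd_push: "hd (map ((*v) T) vs @ [T *v ?y]) = T *v hd (vs @ [?y])"
    by (cases vs) auto
  show ?case
  proof (cases l)
    case Delzant
    have "path_ok (delz (v # vs) @ ?fs) z"
      using corner IH(2) Delzant y by (simp add: start_with_label)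
    then show ?thesis
      using 1 IH low unfolding Delzant x
      by (intro exI[of _ "v # vs"] exI[of _ fs]) auto
  next
    case Fake
    then have v: "v = T *v hd (vs @ [?y])" using corner y by (simp add: strict_corner_simps)
    have "hd (map ((*v) T) vs @ (T *v ?y # fs) @ [z]) = v"
      using hd_push v by (cases vs) auto
    then show ?thesis
      using path_moves_trans[OF 1[unfolded Fake] pushed(1)[OF v]] pushed(2)[OF v] low' IH(5)
      unfolding x Fake
      by (intro exI[of _ "map ((*v) T) vs"] exI[of _ "T *v ?y # fs"]) auto
  next
    case Hidden
    let ?t = "hd (vs @ [?y])"
    let ?vs = "v # map ((*v) T) vs" and ?gs = "T *v ?y # fs"
    have "start (delz vs @ ?fs) z = ?t"
      using y by (simp add: start_with_label)
    then have "path_moves z ((v, Hidden) # delz vs @ ?fs) ([(v, Delzant)] @ ((T *v ?t, Fake) # delz vs @ ?fs) @ [])"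
      using path_moves_context[of "delz vs @ ?fs" z "[(v, Hidden)]" "[(v, Delzant), (T *v ?t, Fake)]" "[]"]
        path_moves_hidden by simp
    also have "path_moves z \<dots> ([(v, Delzant)] @ (delz (map ((*v) T) vs) @ with_label Fake ?gs) @ [])"
      using pushed(1)[of "T *v ?t"] by (intro path_moves_context) simp
    finally have "path_moves z (x # P) (delz ?vs @ with_label Fake ?gs)"
      using path_moves_trans[OF 1] unfolding Hidden by simp
    moreover have "path_ok (delz ?vs @ with_label Fake ?gs) z"
      using pushed(2)[of "T *v ?t"] corner hd_push y unfolding Hidden
      by (simp add: strict_corner_simps start_with_label)
    ultimately show ?thesis
      using low' low(4) IH(5) unfolding x Hidden
      by (intro exI[of _ ?vs] exI[of _ ?gs]) auto
  qed
qed

definition fake_run :: "int \<Rightarrow> nat \<Rightarrow> labelled_vectors" where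
  "fake_run k c = map (\<lambda>n. (vector [k - int c + int n, -1], Fake)) [0..<c]"

lemma fake_run_simps:
  "fake_run k 0 = []"
  "fake_run k (Suc c) = (vector [k - int (Suc c), -1], Fake) # fake_run k c"
proof -
  have "[0..<Suc c] = 0 # map Suc [0..<c]"
    by (simp only: map_Suc_upt upt_conv_Cons zero_less_Suc)
  then show "fake_run k (Suc c) = (vector [k - int (Suc c), -1], Fake) # fake_run k c"
    unfolding fake_run_def by (simp add: algebra_simps del: upt_Suc)
qed (simp add: fake_run_def)

lemma start_fake_run: "start (fake_run k c) (vector [k, -1]) = vector [k - int c, -1]"
  by (cases c) (simp_all add: fake_run_simps)

lemma path_ok_fake_run: "path_ok (fake_run k c) (vector [k, -1])"
  by (induction c) (simp_all add: fake_run_simps start_fake_run strict_corner_simps vec2_eq_iff)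

text \<open>
  Reading backwards from \<open>(k, -1)\<close>, each fake corner starts at the image under \<open>T\<close> of its
  end.
\<close>
lemma fakes_are_fake_run:
  "path_ok (with_label Fake fs) (vector [k, -1]) \<Longrightarrow> with_label Fake fs = fake_run k (length fs)"
  by (induction fs) (simp_all add: fake_run_simps start_fake_run strict_corner_simps vec2_eq_iff)

text \<open>
  Once the defects are at the end, the Delzant part runs from \<open>(-1, 0)\<close> to \<open>(k - c, -1)\<close>,
  where \<open>c\<close> is the number of defects. These two vectors have determinant \<open>1\<close>, so this part
  collapses.
\<close>
lemma lower_half_normal_form:
  assumes "path_ok ((vector [-1, 0], Delzant) # P) (vector [k, -1])"
    and "\<forall>x\<in>set P. fst x $ 2 < 0"
  shows "path_moves (vector [k, -1]) ((vector [-1, 0], Delzant) # P)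
           ((vector [-1, 0], Delzant) # fake_run k (defects P))"
proof -
  let ?z = "vector [k, -1] :: int^2" and ?e = "vector [-1, 0] :: int^2"
  obtain vs fs where P: "path_moves ?z P (delz vs @ with_label Fake fs)"
    "path_ok (delz vs @ with_label Fake fs) ?z" "\<forall>v\<in>set (vs @ fs). v $ 2 < 0"
    "hd (vs @ fs @ [?z]) = start P ?z" "length fs = defects P"
    using sort_defects[of P ?z] assms by auto
  have fs: "with_label Fake fs = fake_run k (defects P)"
    using fakes_are_fake_run P(2,5) unfolding path_ok_append by metis
  let ?y = "vector [k - int (defects P), -1] :: int^2"
  have y: "start (fake_run k (defects P)) ?z = ?y"
    by (rule start_fake_run)
  \<comment> \<open>The corner at \<open>(-1, 0)\<close> is unaffected by the sorting.\<close>
  have "start (delz vs) ?y = start P ?z"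
    using P(4) unfolding y[symmetric] fs[symmetric] by (cases vs) (auto simp: start_with_label)
  then have ok: "path_ok (delz (?e # vs)) ?y"
    using assms(1) P(2) unfolding path_ok_append fs y by simp
  then have "successively (\<lambda>v w. det_cols v w = 1) (vs @ [?y])"
    unfolding path_ok_delz by (cases vs) auto
  then have "sorted_wrt (\<lambda>v w. det_cols v w > 0) (vs @ [?y])"
    using P(3) by (intro half_plane_chain_sorted[of _ "-1"]) auto
  then have "path_moves ?y (delz (?e # vs)) (delz [?e])"
    using P(3) ok by (intro unimodular_cone_collapse) (auto simp: sorted_wrt_append det_cols_eq)
  then have "path_moves ?z ([] @ delz (?e # vs) @ fake_run k (defects P))
      ([] @ delz [?e] @ fake_run k (defects P))"
    by (intro path_moves_context) (simp only: y)
  moreover have "path_moves ?z ([(?e, Delzant)] @ P @ []) ([(?e, Delzant)] @ (delz vs @ with_label Fake fs) @ [])"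
    using P(1) by (intro path_moves_context) simp
  ultimately show ?thesis
    using path_moves_trans fs by simp
qed


section \<open>The upper half-plane\<close>

lemma vector_2_add: "(vector [a, b] :: int^2) + vector [a', b'] = vector [a + a', b + b']"
  by (simp add: vec2_eq_iff)

text \<open>
  Insert the neighbour \<open>(a \<plusminus> 1, 1)\<close> of \<open>(a, 1)\<close> as its sum with \<open>(1, 0)\<close> or with \<open>(-1, 0)\<close>.
  Then \<open>(a, 1)\<close> is itself the sum of its new neighbours and can be removed.
\<close>
lemma upper_slide:
  "path_moves (vector [-1, 0]) (delz [vector [1, 0], vector [a, 1]]) (delz [vector [1, 0], vector [b, 1]])"
proof (induction b rule: int_induct[of _ a])
  case base
  show ?case by simp
next
  case (step1 i)
  let ?e = "vector [1, 0] :: int^2" and ?v = "\<lambda>i. vector [i, 1] :: int^2"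
  note step1.IH
  also have "path_moves (vector [-1, 0]) (delz [?e, ?v i]) (delz [?e, ?v (i + 1), ?v i])"
    using path_moves_context[of "delz [?v i]" "vector [-1, 0]" _ _ "[]", OF path_moves_chop[of _ ?e]]
    by (simp add: vector_2_add add.commute)
  also have "path_moves (vector [-1, 0]) \<dots> (delz [?e, ?v (i + 1)])"
    using path_moves_context[of "[]" "vector [-1, 0]" _ _ "delz [?e]",
        OF path_moves_reverse_chop[of "?v i" "?v (i + 1)"]]
    by (simp add: vec2_eq_iff)
  finally show ?case .
next
  case (step2 i)
  let ?e = "vector [1, 0] :: int^2" and ?v = "\<lambda>i. vector [i, 1] :: int^2"
  note step2.IH
  also have "path_moves (vector [-1, 0]) (delz [?e, ?v i]) (delz [?e, ?v i, ?v (i - 1)])"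
    using path_moves_context[of "[]" "vector [-1, 0]" _ _ "delz [?e]", OF path_moves_chop[of _ "?v i"]]
    by (simp add: vector_2_add)
  also have "path_moves (vector [-1, 0]) \<dots> (delz [?e, ?v (i - 1)])"
    using path_moves_context[of "delz [?v (i - 1)]" "vector [-1, 0]" _ _ "[]",
        OF path_moves_reverse_chop[of "?v i" ?e]]
    by (simp add: vec2_eq_iff)
  finally show ?case .
qed

lemma upper_half_normal_form:
  assumes ok: "path_ok (delz (vector [1, 0] # us)) (vector [-1, 0])"
    and up: "\<forall>u\<in>set us. u $ 2 > 0"
  shows "path_moves (vector [-1, 0]) (delz (vector [1, 0] # us)) (delz [vector [1, 0], vector [a, 1]])"
proof -
  let ?e = "vector [1, 0] :: int^2" and ?f = "vector [-1, 0] :: int^2"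
  obtain u us' where us: "us = u # us'"
    using ok by (cases us) (auto simp: strict_corner_simps det_cols_eq)
  have ok': "path_ok (delz (u # us')) ?f" and "u $ 2 = 1"
    using ok by (auto simp: us strict_corner_simps det_cols_eq)
  then have u: "u = vector [u $ 1, 1]" by (simp add: vec2_eq_iff)
  have "successively (\<lambda>v w. det_cols v w = 1) (u # us')"
    using ok' unfolding path_ok_delz by (simp add: successively_append_iff flip: append_Cons)
  then have "sorted_wrt (\<lambda>v w. det_cols v w > 0) (u # us')"
    using up us by (intro half_plane_chain_sorted[of _ 1]) auto
  then have "path_moves ?f (delz (u # us')) (delz [u])"
    using ok' up us \<open>u $ 2 = 1\<close> by (intro unimodular_cone_collapse) (auto simp: det_cols_eq)
  then have "path_moves ?f (delz (?e # us)) (delz [?e, u])"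
    using path_moves_context[of "[]" ?f _ _ "delz [?e]"] us by simp
  also have "path_moves ?f \<dots> (delz [?e, vector [a, 1]])"
    by (subst u) (rule upper_slide)
  finally show ?thesis .
qed


section \<open>Cutting a fan along the horizontal axis\<close>

lemma has_angle_shift: "has_angle v \<theta> \<Longrightarrow> has_angle v (\<theta> + 2 * pi * of_int m)"
  unfolding has_angle_def by (simp add: cos_add sin_add cos_int_2pin sin_int_2pin)

lemma has_angle_sgn:
  assumes "has_angle v \<theta>"
  shows "0 < \<theta> \<Longrightarrow> \<theta> < pi \<Longrightarrow> v $ 2 > 0"
    and "pi < \<theta> \<Longrightarrow> \<theta> < 2 * pi \<Longrightarrow> v $ 2 < 0"
proof -
  obtain r where r: "r > 0" "real_of_int (v $ 2) = r * sin \<theta>"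
    using assms unfolding has_angle_def by blast
  show "v $ 2 > 0" if "0 < \<theta>" "\<theta> < pi"
    using r sin_gt_zero[OF that] by (metis mult_pos_pos of_int_0_less_iff)
  show "v $ 2 < 0" if "pi < \<theta>" "\<theta> < 2 * pi"
    using r sin_lt_zero[OF that] by (metis mult_pos_neg of_int_less_0_iff)
qed

lemma has_angle_axis:
  assumes "has_angle v \<theta>" "primitive v"
  shows "\<theta> = pi \<Longrightarrow> v = vector [-1, 0]" and "\<theta> = 2 * pi \<Longrightarrow> v = vector [1, 0]"
proof -
  obtain r where r: "r > 0" "real_of_int (v $ 1) = r * cos \<theta>" "real_of_int (v $ 2) = r * sin \<theta>"
    using assms unfolding has_angle_def by blast
  show "v = vector [-1, 0]" if "\<theta> = pi"
  proof -
    have "v $ 2 = 0" "v $ 1 < 0" using r that by auto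
    then show ?thesis using assms(2) by (auto simp: primitive_def vec2_eq_iff)
  qed
  show "v = vector [1, 0]" if "\<theta> = 2 * pi"
  proof -
    have "v $ 2 = 0" "v $ 1 > 0" using r that by auto
    then show ?thesis using assms(2) by (auto simp: primitive_def vec2_eq_iff)
  qed
qed

text \<open>
  If \<open>w\<close> comes after \<open>v\<close> only once the angle wraps around, a positive determinant forces the
  difference of the angles to exceed \<open>\<pi>\<close>.
\<close>
lemma det_cols_pos_angles:
  assumes "has_angle v \<alpha>" "has_angle w \<beta>" "det_cols v w > 0" "\<beta> < \<alpha>" "\<alpha> < \<beta> + 2 * pi"
  shows "\<beta> + pi < \<alpha>"
proof (rule ccontr)
  assume "\<not> \<beta> + pi < \<alpha>"
  then have "sin (\<alpha> - \<beta>) \<ge> 0" using assms(4) by (intro sin_ge_zero) auto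
  moreover obtain r s where rs: "r > 0" "s > 0"
    "real_of_int (v $ 1) = r * cos \<alpha>" "real_of_int (v $ 2) = r * sin \<alpha>"
    "real_of_int (w $ 1) = s * cos \<beta>" "real_of_int (w $ 2) = s * sin \<beta>"
    using assms(1,2) unfolding has_angle_def by blast
  have "real_of_int (det_cols v w) = - (r * s * sin (\<alpha> - \<beta>))"
    unfolding det_cols_eq of_int_diff of_int_mult rs by (simp add: sin_diff algebra_simps)
  ultimately have "real_of_int (det_cols v w) \<le> 0" using rs by simp
  then show False using assms(3) by simp
qed

text \<open>
  Shift all angles by a multiple of \<open>2\<pi>\<close> so that the first one lies in \<open>(-2\<pi>, 0]\<close>. The
  angles that are at most \<open>0\<close> form an initial segment; adding \<open>2\<pi>\<close> to them moves this
  segment to the end.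
\<close>
lemma rotated_angles:
  assumes "counterclockwise_once (map fst F)" "F \<noteq> []"
  shows "\<exists>A B \<phi>s. F = A @ B \<and> list_all2 has_angle (map fst (B @ A)) \<phi>s \<and> sorted_wrt (<) \<phi>s \<and>
           (\<forall>\<phi>\<in>set \<phi>s. 0 < \<phi> \<and> \<phi> \<le> 2 * pi)"
proof -
  obtain \<theta>s where \<theta>s: "list_all2 has_angle (map fst F) \<theta>s" "sorted_wrt (<) \<theta>s"
    "last \<theta>s < hd \<theta>s + 2 * pi"
    using assms(1) unfolding counterclockwise_once_def by blast
  have ne: "\<theta>s \<noteq> []" using \<theta>s(1) assms(2) by auto
  define m where "m = - \<lceil>hd \<theta>s / (2 * pi)\<rceil>"
  define sh where "sh = (\<lambda>t. t + 2 * pi * real_of_int m)"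
  define \<psi>s where "\<psi>s = map sh \<theta>s"
  have "hd \<theta>s / (2 * pi) \<le> - of_int m" "- of_int m < hd \<theta>s / (2 * pi) + 1"
    unfolding m_def using ceiling_correct[of "hd \<theta>s / (2 * pi)"] by auto
  then have "hd \<theta>s \<le> - (2 * pi * of_int m)" "- (2 * pi * of_int m) < hd \<theta>s + 2 * pi"
    using pi_gt_zero by (simp_all add: field_simps)
  then have hd_\<psi>: "hd \<psi>s \<le> 0" "- (2 * pi) < hd \<psi>s"
    unfolding \<psi>s_def sh_def using ne by (simp_all add: hd_map)
  have sorted: "sorted_wrt (<) \<psi>s"
    unfolding \<psi>s_def sh_def using \<theta>s(2) by (simp add: sorted_wrt_map)
  have last_\<psi>: "last \<psi>s < hd \<psi>s + 2 * pi"
    unfolding \<psi>s_def sh_def using \<theta>s(3) ne by (simp add: hd_map last_map)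
  have bounds: "hd \<psi>s \<le> t" "t \<le> last \<psi>s" if "t \<in> set \<psi>s" for t
  proof -
    show "hd \<psi>s \<le> t" using sorted that by (cases \<psi>s) auto
    show "t \<le> last \<psi>s" using sorted that by (cases \<psi>s rule: rev_cases) (auto simp: sorted_wrt_append)
  qed
  define \<alpha>s where "\<alpha>s = takeWhile (\<lambda>t. t \<le> 0) \<psi>s"
  define \<beta>s where "\<beta>s = dropWhile (\<lambda>t. t \<le> 0) \<psi>s"
  have \<psi>s: "\<psi>s = \<alpha>s @ \<beta>s" unfolding \<alpha>s_def \<beta>s_def by simp
  have \<alpha>: "t \<le> 0" if "t \<in> set \<alpha>s" for t
    using that unfolding \<alpha>s_def by (meson set_takeWhileD)
  have \<beta>: "t > 0" if "t \<in> set \<beta>s" for t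
  proof -
    have "\<beta>s \<noteq> []" using that by auto
    then have "hd \<beta>s > 0" 
      using hd_dropWhile[of "\<lambda>t. t \<le> 0" \<psi>s] unfolding \<beta>s_def by simp
    moreover have "hd \<beta>s \<le> t"
      using sorted that \<open>\<beta>s \<noteq> []\<close> unfolding \<psi>s by (cases \<beta>s) (auto simp: sorted_wrt_append)
    ultimately show ?thesis by simp
  qed
  have "list_all2 has_angle (map fst F) (\<alpha>s @ \<beta>s)"
    unfolding \<psi>s[symmetric] \<psi>s_def sh_def using \<theta>s(1)
    by (auto simp: list_all2_conv_all_nth has_angle_shift)
  then obtain xs ys where xy: "map fst F = xs @ ys" "list_all2 has_angle xs \<alpha>s" "list_all2 has_angle ys \<beta>s"
    by (meson list_all2_append2)
  then obtain A B where F: "F = A @ B" "map fst A = xs" "map fst B = ys"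
    by (auto simp: map_eq_append_conv)
  have "list_all2 has_angle (map fst A) (map (\<lambda>t. t + 2 * pi) \<alpha>s)"
    using xy(2) F(2) has_angle_shift[of _ _ 1] by (auto simp: list_all2_conv_all_nth)
  then have "list_all2 has_angle (map fst (B @ A)) (\<beta>s @ map (\<lambda>t. t + 2 * pi) \<alpha>s)"
    using xy(3) F(3) by (simp add: list_all2_appendI)
  moreover have "b < a + 2 * pi" if "a \<in> set \<alpha>s" "b \<in> set \<beta>s" for a b
    using bounds[of a] bounds[of b] last_\<psi> that \<psi>s by simp
  then have "sorted_wrt (<) (\<beta>s @ map (\<lambda>t. t + 2 * pi) \<alpha>s)"
    using sorted unfolding \<psi>s by (auto simp: sorted_wrt_append sorted_wrt_map)
  moreover have "0 < t \<and> t \<le> 2 * pi" if t: "t \<in> set (\<beta>s @ map (\<lambda>t. t + 2 * pi) \<alpha>s)" for t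
  proof (cases "t \<in> set \<beta>s")
    case True
    then show ?thesis using \<beta> bounds[of t] last_\<psi> hd_\<psi> \<psi>s by simp
  next
    case False
    then obtain a where "a \<in> set \<alpha>s" "t = a + 2 * pi" using t by auto
    then show ?thesis using \<alpha>[of a] bounds[of a] hd_\<psi> \<psi>s by simp
  qed
  ultimately show ?thesis using F(1) by blast
qed

lemma split_by_half_planes:
  assumes "list_all2 has_angle (map fst F) \<phi>s" "sorted_wrt (<) \<phi>s"
    and "\<forall>\<phi>\<in>set \<phi>s. 0 < \<phi> \<and> \<phi> < 2 * pi" "\<forall>x\<in>set F. primitive (fst x)"
  shows "\<exists>U M L. F = U @ M @ L \<and> (\<forall>x\<in>set U. fst x $ 2 > 0) \<and> (\<forall>x\<in>set L. fst x $ 2 < 0) \<and>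
           (M = [] \<or> (\<exists>l. M = [(vector [-1, 0], l)]))"
  using assms
proof (induction F arbitrary: \<phi>s)
  case (Cons x F)
  then obtain \<phi> \<psi>s where \<phi>s: "\<phi>s = \<phi> # \<psi>s" "has_angle (fst x) \<phi>" "list_all2 has_angle (map fst F) \<psi>s"
    by (auto simp: list_all2_Cons1)
  have lower: "\<forall>y\<in>set F. fst y $ 2 < 0" if "pi \<le> \<phi>"
  proof
    fix y assume "y \<in> set F"
    then obtain i where i: "i < length F" "y = F ! i" by (auto simp: in_set_conv_nth)
    then have "i < length \<psi>s" "has_angle (fst y) (\<psi>s ! i)"
      using \<phi>s(3) by (auto simp: list_all2_conv_all_nth)
    moreover from this have "\<phi> < \<psi>s ! i" "\<psi>s ! i < 2 * pi"
      using Cons.prems(2,3) \<phi>s(1) by auto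
    ultimately show "fst y $ 2 < 0" using has_angle_sgn(2) that by force
  qed
  consider "\<phi> < pi" | "\<phi> = pi" | "\<phi> > pi" by linarith
  then show ?case
  proof cases
    case 1
    then have "fst x $ 2 > 0" using has_angle_sgn(1)[OF \<phi>s(2)] Cons.prems(3) \<phi>s(1) by simp
    moreover obtain U M L where "F = U @ M @ L" "\<forall>x\<in>set U. fst x $ 2 > 0"
      "\<forall>x\<in>set L. fst x $ 2 < 0" "M = [] \<or> (\<exists>l. M = [(vector [-1, 0], l)])"
      using Cons.IH[OF \<phi>s(3)] Cons.prems \<phi>s(1) by auto
    ultimately show ?thesis by (intro exI[of _ "x # U"] exI[of _ M] exI[of _ L]) auto
  next
    case 2
    then have "x = (vector [-1, 0], snd x)"
      using has_angle_axis(1)[OF \<phi>s(2)] Cons.prems(4) by (simp add: prod_eq_iff)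
    then show ?thesis
      using lower 2 by (intro exI[of _ "[]"] exI[of _ "[x]"] exI[of _ F]) auto
  next
    case 3
    then have "fst x $ 2 < 0" using has_angle_sgn(2)[OF \<phi>s(2)] Cons.prems(3) \<phi>s(1) by simp
    then show ?thesis
      using lower 3 by (intro exI[of _ "[]"] exI[of _ "[]"] exI[of _ "x # F"]) auto
  qed
qed simp

text \<open>
  Rotate the list such that its angles lie in \<open>(0, 2\<pi>]\<close>. The closing corner, from the last
  vector to the first, then crosses the direction \<open>(1, 0)\<close>, or it starts there if the last
  angle is \<open>2\<pi>\<close>. Because it spans less than \<open>\<pi>\<close>, it ends above the axis and is therefore a
  Delzant corner; if \<open>(1, 0)\<close> is not its start, it is subdivided at \<open>(1, 0)\<close>.
\<close>
lemma fan_cut_at_right_axis: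
  assumes "semitoric_fan F"
  shows "\<exists>U M L. leads_to F ((vector [1, 0], Delzant) # U @ M @ L) \<and>
           closed_path_ok ((vector [1, 0], Delzant) # U @ M @ L) \<and>
           (\<forall>x\<in>set U. fst x $ 2 > 0) \<and> (\<forall>x\<in>set L. fst x $ 2 < 0) \<and>
           (M = [] \<or> (\<exists>l. M = [(vector [-1, 0], l)])) \<and> defects (U @ M @ L) = defect F"
proof -
  let ?e = "vector [1, 0] :: int^2"
  have fan: "length F > 2" "\<forall>x\<in>set F. primitive (fst x)" "counterclockwise_once (map fst F)"
    using assms unfolding semitoric_fan_def by (simp_all add: all_set_conv_all_nth)
  have "strict_corner (snd (F ! i)) (fst (F ! i)) (fst (F ! (Suc i mod length F)))"
    if "i < length F" for i
  proof (rule strict_corner_of_corner_ok)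
    have "Suc i mod length F < length F" using that by (intro mod_less_divisor) linarith
    then show "primitive (fst (F ! (Suc i mod length F)))" using fan(2) by simp
  qed (use assms that in \<open>auto simp: semitoric_fan_def\<close>)
  then have closed: "closed_path_ok F" unfolding closed_path_ok_iff_nth by blast
  have "F \<noteq> []" using fan(1) by auto
  then obtain A B \<phi>s where AB: "F = A @ B" "list_all2 has_angle (map fst (B @ A)) \<phi>s"
    "sorted_wrt (<) \<phi>s" "\<forall>\<phi>\<in>set \<phi>s. 0 < \<phi> \<and> \<phi> \<le> 2 * pi"
    using rotated_angles[OF fan(3)] by blast
  have len: "length (B @ A) > 2" using fan(1) AB(1) by simp
  have closed': "closed_path_ok (B @ A)" using closed AB(1) closed_path_ok_append_commute by blast
  have rot: "leads_to F (B @ A)" using AB(1) cyclic_relabelling_append leads_to_relabel by blast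
  have defect: "defects (B @ A) = defect F" unfolding AB(1) by (simp add: defect_eq_defects)
  have prim: "\<forall>x\<in>set (B @ A). primitive (fst x)" using fan(2) AB(1) by auto
  obtain v0 l0 F' vl ll where G: "B @ A = (v0, l0) # F' @ [(vl, ll)]"
  proof -
    obtain x y Z where "B @ A = x # y # Z" using len by (cases "B @ A"; cases "tl (B @ A)") auto
    moreover obtain Z' z where "y # Z = Z' @ [z]" by (metis append_butlast_last_id list.distinct(1))
    ultimately show thesis using that[of "fst x" "snd x" Z' "fst z" "snd z"] by simp
  qed
  obtain \<alpha> \<psi>s \<beta> where \<phi>s: "\<phi>s = \<alpha> # \<psi>s @ [\<beta>]" "has_angle v0 \<alpha>" "has_angle vl \<beta>"
    "list_all2 has_angle (map fst F') \<psi>s"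
    using AB(2) unfolding G by (auto simp: list_all2_Cons1 list_all2_append1)
  have corner: "strict_corner ll vl v0"
    using closed' unfolding G by (simp add: path_ok_append)
  have "\<alpha> < \<beta>" "0 < \<alpha>" "\<beta> \<le> 2 * pi" using AB(3,4) unfolding \<phi>s(1) by (auto simp: sorted_wrt_append)
  then have "\<alpha> + pi < \<beta>"
    using det_cols_pos_angles[OF \<phi>s(3,2) det_cols_pos_of_strict_corner[OF corner]] by simp
  then have v0: "v0 $ 2 > 0" using has_angle_sgn(1)[OF \<phi>s(2)] \<open>0 < \<alpha>\<close> \<open>\<beta> \<le> 2 * pi\<close> by simp
  have D: "ll = Delzant" using strict_corner_Delzant[OF corner] v0 by simp
  show ?thesis
  proof (cases "\<beta> = 2 * pi")
    case True
    have vl: "vl = ?e" using has_angle_axis(2)[OF \<phi>s(3) _ True] prim unfolding G by simp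
    let ?A = "(v0, l0) # F'"
    have "list_all2 has_angle (map fst ?A) (\<alpha> # \<psi>s)" using \<phi>s by simp
    moreover have "\<forall>\<phi>\<in>set (\<alpha> # \<psi>s). 0 < \<phi> \<and> \<phi> < 2 * pi" "sorted_wrt (<) (\<alpha> # \<psi>s)"
      using AB(3,4) unfolding \<phi>s(1) by (auto simp: sorted_wrt_append True)
    moreover have "\<forall>x\<in>set ?A. primitive (fst x)" using prim unfolding G by simp
    ultimately obtain U M L where UML: "?A = U @ M @ L" "\<forall>x\<in>set U. fst x $ 2 > 0"
      "\<forall>x\<in>set L. fst x $ 2 < 0" "M = [] \<or> (\<exists>l. M = [(vector [-1, 0], l)])"
      using split_by_half_planes[of ?A "\<alpha> # \<psi>s"] by blast
    have G': "B @ A = (U @ M @ L) @ [(?e, Delzant)]"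
      unfolding UML(1)[symmetric] G by (simp add: D vl)
    have "leads_to F ([(?e, Delzant)] @ U @ M @ L)"
      using leads_to_trans[OF rot] leads_to_relabel[OF cyclic_relabelling_append] G' by metis
    moreover have "closed_path_ok ([(?e, Delzant)] @ U @ M @ L)"
      using closed' closed_path_ok_append_commute G' by metis
    moreover have "defects (U @ M @ L) = defect F" using defect unfolding G' by simp
    ultimately show ?thesis using UML by auto
  next
    case False
    have "\<forall>\<phi>\<in>set \<phi>s. 0 < \<phi> \<and> \<phi> < 2 * pi"
      using AB(3,4) False \<open>\<beta> \<le> 2 * pi\<close> unfolding \<phi>s(1) by (auto simp: sorted_wrt_append)
    then obtain U M L where UML: "B @ A = U @ M @ L" "\<forall>x\<in>set U. fst x $ 2 > 0"
      "\<forall>x\<in>set L. fst x $ 2 < 0" "M = [] \<or> (\<exists>l. M = [(vector [-1, 0], l)])"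
      using split_by_half_planes[OF AB(2,3)] prim by blast
    have vl: "vl $ 2 < 0"
      using has_angle_sgn(2)[OF \<phi>s(3)] \<open>\<alpha> + pi < \<beta>\<close> \<open>0 < \<alpha>\<close> \<open>\<beta> \<le> 2 * pi\<close> False by simp
    have last: "last (U @ M @ L) = (vl, ll)" "U @ M @ L \<noteq> []" unfolding UML(1)[symmetric] G by simp_all
    have "L \<noteq> []"
    proof
      assume "L = []"
      then have "(vl, ll) \<in> set U \<union> set M" using last by (metis Un_iff append_Nil2 last_in_set set_append)
      then show False using UML(2,4) vl by fastforce
    qed
    then obtain L' where L: "L = L' @ [(vl, Delzant)]"
      using last(1) D by (metis append_butlast_last_id append_is_Nil_conv last_appendR)
    have e: "det_cols vl ?e > 0" "det_cols ?e v0 > 0" "primitive ?e"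
      using vl v0 by (simp_all add: det_cols_eq primitive_def)
    have det: "det_cols vl v0 = 1" using corner D by (simp add: strict_corner_simps)
    \<comment> \<open>The inserted vectors \<open>ps\<close> come before \<open>(1, 0)\<close>, below the axis, and \<open>qs\<close> after it, above the axis.\<close>
    obtain ps qs where pq: "path_moves v0 (delz [vl]) (delz (vl # ps @ ?e # qs))"
      "path_ok (delz (vl # ps @ ?e # qs)) v0" "\<forall>p\<in>set ps. det_cols p ?e > 0" "\<forall>q\<in>set qs. det_cols ?e q > 0"
      using corner_subdivision[OF det e(1,2) coprime_unimodular_coordinates[OF det e(3)]] by blast
    let ?C = "U @ M @ L'"
    have C: "B @ A = ?C @ delz [vl]" unfolding UML(1) L by simp
    then have C_hd: "?C \<noteq> []" "fst (hd ?C) = v0"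
      using G len by (cases ?C; simp)+
    let ?U = "delz qs @ U" and ?L = "L' @ delz (vl # ps)"
    have "leads_to (B @ A) (?C @ delz (vl # ps @ ?e # qs))"
      using leads_to_path_moves[of "[]" ?C "delz [vl]"] pq(1) C C_hd by simp
    also have "leads_to \<dots> ((?e, Delzant) # ?U @ M @ ?L)"
      using leads_to_relabel[OF cyclic_relabelling_append[of "?C @ delz (vl # ps)" "delz (?e # qs)"]] by simp
    finally have 1: "leads_to F ((?e, Delzant) # ?U @ M @ ?L)" using leads_to_trans rot by blast
    have "path_ok ?C vl"
      using closed' unfolding C path_ok_append by simp
    moreover have "hd (?C @ delz (vl # ps @ ?e # qs)) = hd ?C" using C_hd by (metis hd_append2)
    ultimately have "closed_path_ok (?C @ delz (vl # ps @ ?e # qs))"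
      using pq(2) C_hd(2) unfolding path_ok_append by simp
    then have "closed_path_ok (delz (?e # qs) @ (?C @ delz (vl # ps)))"
      by (subst closed_path_ok_append_commute) simp
    then have 2: "closed_path_ok ((?e, Delzant) # ?U @ M @ ?L)" by simp
    have 3: "\<forall>x\<in>set ?U. fst x $ 2 > 0" "\<forall>x\<in>set ?L. fst x $ 2 < 0"
      using UML(2,3) pq(3,4) vl unfolding L by (auto simp: det_cols_eq)
    have 4: "defects (?U @ M @ ?L) = defect F"
      using defect unfolding C by simp
    show ?thesis using 1 2 3 4 UML(4) by blast
  qed
qed

text \<open>
  If \<open>(-1, 0)\<close> is not yet in the fan, determinants show that vectors on both sides of the
  axis occur. The corner that crosses the axis starts above it, hence it is a Delzant corner
  and can be subdivided.
\<close>
lemma fan_cut_at_axis: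
  assumes "semitoric_fan F"
  shows "\<exists>U L. leads_to F ((vector [1, 0], Delzant) # U @ (vector [-1, 0], Delzant) # L) \<and>
           closed_path_ok ((vector [1, 0], Delzant) # U @ (vector [-1, 0], Delzant) # L) \<and>
           (\<forall>x\<in>set U. fst x $ 2 > 0) \<and> (\<forall>x\<in>set L. fst x $ 2 < 0) \<and> defects (U @ L) = defect F"
proof -
  let ?e = "vector [1, 0] :: int^2" and ?f = "vector [-1, 0] :: int^2"
  obtain U M L where 1: "leads_to F ((?e, Delzant) # U @ M @ L)"
      "closed_path_ok ((?e, Delzant) # U @ M @ L)"
      "\<forall>x\<in>set U. fst x $ 2 > 0" "\<forall>x\<in>set L. fst x $ 2 < 0"
      "M = [] \<or> (\<exists>l. M = [(?f, l)])" "defects (U @ M @ L) = defect F"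
    using fan_cut_at_right_axis[OF assms] by metis
  from 1(5) show ?thesis
  proof
    assume "\<exists>l. M = [(?f, l)]"
    then obtain l where M: "M = [(?f, l)]" by blast
    have "strict_corner l ?f (start L ?e)"
      using 1(2) unfolding M by (simp add: path_ok_append)
    then have "l = Delzant" using strict_corner_Delzant by fastforce
    then show ?thesis using 1 M by (intro exI[of _ U] exI[of _ L]) auto
  next
    assume M: "M = []"
    have ok: "strict_corner Delzant ?e (start (U @ L) ?e)" "path_ok U (start L ?e)" "path_ok L ?e"
      using 1(2) unfolding M by (auto simp: path_ok_append)
    \<comment> \<open>An empty \<open>U\<close> would give a corner from \<open>(1, 0)\<close> to a vector below the axis or to itself.\<close>
    obtain U' u where U: "U = U' @ [(u, Delzant)]"
    proof (cases U rule: rev_cases)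
      case Nil
      then show ?thesis using ok(1) 1(4) by (cases L) (auto simp: strict_corner_simps det_cols_eq)
    next
      case (snoc U' x)
      obtain u l where x: "x = (u, l)" by force
      have "strict_corner l u (start L ?e)" using ok(2) snoc x by (simp add: path_ok_append)
      moreover have "u $ 2 > 0" using 1(3) snoc x by simp
      ultimately have "l = Delzant" by (intro strict_corner_Delzant[of l]) auto
      then show ?thesis using that snoc x by simp
    qed
    have u: "u $ 2 > 0" using 1(3) U by simp
    have corner: "det_cols u (start L ?e) = 1" using ok(2) unfolding U by (simp add: path_ok_append strict_corner_simps)
    obtain w l L' where L: "L = (w, l) # L'"
      using corner u by (cases L) (auto simp: det_cols_eq)
    have w: "w $ 2 < 0" using 1(4) L by simp
    have det: "det_cols u w = 1" using corner L by simp
    have f: "det_cols u ?f > 0" "det_cols ?f w > 0" "primitive ?f"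
      using u w by (simp_all add: det_cols_eq primitive_def)
    obtain ps qs where pq: "path_moves w (delz [u]) (delz (u # ps @ ?f # qs))"
      "path_ok (delz (u # ps @ ?f # qs)) w" "\<forall>p\<in>set ps. det_cols p ?f > 0" "\<forall>q\<in>set qs. det_cols ?f q > 0"
      using corner_subdivision[OF det f(1,2) coprime_unimodular_coordinates[OF det f(3)]] by blast
    let ?A = "(?e, Delzant) # U'"
    let ?U = "U' @ delz (u # ps)" and ?L = "delz qs @ L"
    have "leads_to (?A @ delz [u] @ L) (?A @ delz (u # ps @ ?f # qs) @ L)"
      using pq(1) L by (intro leads_to_path_moves) simp_all
    moreover have "leads_to F (?A @ delz [u] @ L)" using 1(1) unfolding M U by simp
    ultimately have "leads_to F ((?e, Delzant) # ?U @ (?f, Delzant) # ?L)"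
      using leads_to_trans by fastforce
    moreover have "closed_path_ok (?A @ delz [u] @ L)" using 1(2) unfolding M U by simp
    then have "closed_path_ok (?A @ delz (u # ps @ ?f # qs) @ L)"
      using pq(2) L by (simp add: path_ok_append)
    then have "closed_path_ok ((?e, Delzant) # ?U @ (?f, Delzant) # ?L)" by simp
    moreover have "\<forall>x\<in>set ?U. fst x $ 2 > 0" "\<forall>x\<in>set ?L. fst x $ 2 < 0"
      using 1(3,4) pq(3,4) u unfolding U by (auto simp: det_cols_eq)
    moreover have "defects (?U @ ?L) = defect F"
      using 1(6) unfolding M U by simp
    ultimately show ?thesis by blast
  qed
qed


section \<open>The normal form\<close>

text \<open>
  The vector \<open>(c - k, 1)\<close> is chosen such that \<open>T\<^sup>k\<close> maps it to \<open>(c, 1)\<close> and \<open>(k, -1)\<close> to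
  \<open>(0, -1)\<close>.
\<close>
definition normal_form :: "nat \<Rightarrow> int \<Rightarrow> labelled_vectors" where
  "normal_form c k = delz [vector [1, 0], vector [int c - k, 1], vector [-1, 0]] @ fake_run k c @
     delz [vector [k, -1]]"

lemma leads_to_normal_form:
  assumes "semitoric_fan F"
  shows "\<exists>k. leads_to F (normal_form (defect F) k)"
proof -
  let ?e = "vector [1, 0] :: int^2" and ?f = "vector [-1, 0] :: int^2"
  obtain U L where 1: "leads_to F ((?e, Delzant) # U @ (?f, Delzant) # L)"
      "closed_path_ok ((?e, Delzant) # U @ (?f, Delzant) # L)"
      "\<forall>x\<in>set U. fst x $ 2 > 0" "\<forall>x\<in>set L. fst x $ 2 < 0" "defects (U @ L) = defect F"
    using fan_cut_at_axis[OF assms] by metis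
  have okU: "path_ok ((?e, Delzant) # U) ?f" and okL: "path_ok ((?f, Delzant) # L) ?e"
    using 1(2) by (auto simp: path_ok_append)
  define us where "us = map fst U"
  have "path_ok U ?f \<Longrightarrow> \<forall>x\<in>set U. fst x $ 2 > 0 \<Longrightarrow> U = delz (map fst U)"
  proof (induction U)
    case (Cons x U)
    obtain v l where x: "x = (v, l)" by force
    have "l = Delzant" using Cons.prems x by (intro strict_corner_Delzant[of l v]) auto
    then show ?case using Cons x by simp
  qed simp
  then have U: "U = delz us" using okU 1(3) us_def by simp
  have "L \<noteq> []" using okL by (auto simp: strict_corner_simps det_cols_eq)
  then obtain L' z l where L: "L = L' @ [(z, l)]" by (metis rev_exhaust surj_pair)
  \<comment> \<open>The corner into \<open>(1, 0)\<close> has determinant \<open>1\<close>, so its first vector is at height \<open>-1\<close>.\<close>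
  have corner: "strict_corner l z ?e" using okL L by (simp add: path_ok_append)
  then have l: "l = Delzant" by (intro strict_corner_Delzant[of l z ?e]) auto
  define k where "k = z $ 1"
  have z: "z = vector [k, -1]"
    using corner l by (auto simp: strict_corner_simps det_cols_eq vec2_eq_iff k_def)
  let ?c = "defect F"
  have c: "defects L' = ?c" using 1(5) unfolding U L l by simp
  let ?R = "delz [z]"
  have "leads_to F ((delz (?e # us) @ [(?f, Delzant)] @ L') @ ?R)"
    using 1(1) unfolding U L l by simp
  also have "leads_to \<dots> (delz (?e # us) @ ([(?f, Delzant)] @ fake_run k ?c) @ ?R)"
  proof -
    have "path_ok ((?f, Delzant) # L') z" using okL unfolding L by (simp add: path_ok_append)
    then have "path_moves z ((?f, Delzant) # L') ((?f, Delzant) # fake_run k ?c)"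
      using lower_half_normal_form[of L' k] 1(4) c unfolding z L by simp
    then show ?thesis
      using leads_to_path_moves[of ?R "delz (?e # us)" "(?f, Delzant) # L'" "(?f, Delzant) # fake_run k ?c"]
      by simp
  qed
  also have "leads_to \<dots> (([(?f, Delzant)] @ fake_run k ?c @ ?R) @ delz (?e # us) @ [])"
    using leads_to_relabel[OF cyclic_relabelling_append[of "delz (?e # us)" "[(?f, Delzant)] @ fake_run k ?c @ ?R"]]
    by simp
  also have "leads_to \<dots> (([(?f, Delzant)] @ fake_run k ?c @ ?R) @ delz [?e, vector [int ?c - k, 1]] @ [])"
  proof (rule leads_to_path_moves)
    have "path_moves ?f (delz (?e # us)) (delz [?e, vector [int ?c - k, 1]])"
      using okU 1(3) unfolding U by (intro upper_half_normal_form) auto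
    then show "path_moves (start [] (fst (hd ([(?f, Delzant)] @ fake_run k ?c @ ?R))))
      (delz (?e # us)) (delz [?e, vector [int ?c - k, 1]])" by simp
  qed simp
  also have "leads_to \<dots> (normal_form ?c k)"
    using leads_to_relabel[OF cyclic_relabelling_append[of "[(?f, Delzant)] @ fake_run k ?c @ ?R"
          "delz [?e, vector [int ?c - k, 1]]"]]
    unfolding normal_form_def z by simp
  finally show ?thesis by blast
qed

lemma normal_form_equivalent: "G'_equivalent (normal_form c k) (standard_fan c)"
proof -
  have T_pow: "T_pow k *v vector [x, y] = vector [x + k * y, y]" for x y
    by (simp add: vec2_eq_iff T_pow_def matrix_vector_mult_def sum_2)
  let ?X = "delz [vector [1, 0], vector [int c, 1], vector [-1, 0]] @ fake_run 0 c"
  have run: "act (T_pow k) (fake_run k c) = fake_run 0 c"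
    unfolding act_def fake_run_def by (simp add: T_pow algebra_simps)
  have "act (T_pow k) (normal_form c k) = ?X @ delz [vector [0, -1]]"
    using run unfolding normal_form_def by (simp add: act_def T_pow)
  moreover have "standard_fan c = delz [vector [0, -1]] @ ?X"
    unfolding standard_fan_def fake_run_def by simp
  ultimately show ?thesis
    unfolding G'_equivalent_def using cyclic_relabelling_append by metis
qed

lemma has_angle_upper: "has_angle (vector [x, 1]) (pi / 2 - arctan (of_int x))"
  unfolding has_angle_def
  by (intro exI[of _ "sqrt (1 + (of_int x)\<^sup>2)"])
    (simp add: cos_diff sin_diff sin_arctan cos_arctan add_pos_nonneg less_imp_neq[THEN not_sym])

lemma has_angle_lower: "has_angle (vector [x, -1]) (3 * pi / 2 + arctan (of_int x))"
proof -
  have "cos (3 * pi / 2) = 0" "sin (3 * pi / 2) = -1"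
    using cos_3over2_pi sin_3over2_pi by (simp_all add: algebra_simps)
  then show ?thesis
    unfolding has_angle_def
    by (intro exI[of _ "sqrt (1 + (of_int x)\<^sup>2)"])
      (simp add: cos_add sin_add sin_arctan cos_arctan add_pos_nonneg less_imp_neq[THEN not_sym])
qed

text \<open>
  The polar angle of a vector \<open>(x, \<plusminus>1)\<close> is an explicit monotone function of \<open>arctan x\<close>.
\<close>
lemma normal_form_fan: "semitoric_fan (normal_form c k)"
proof -
  let ?lows = "map (\<lambda>n. vector [k - int c + int n, -1] :: int^2) [0..<Suc c]"
  have vs: "map fst (normal_form c k) = [vector [1, 0], vector [int c - k, 1], vector [-1, 0]] @ ?lows"
    unfolding normal_form_def fake_run_def by simp
  let ?a = "\<lambda>n. 3 * pi / 2 + arctan (of_int (k - int c + int n))"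
  let ?\<theta> = "[0, pi / 2 - arctan (of_int (int c - k)), pi] @ map ?a [0..<Suc c]"
  have angles: "list_all2 has_angle (map fst (normal_form c k)) ?\<theta>"
    unfolding vs
  proof (rule list_all2_appendI)
    have "has_angle (vector [1, 0]) 0" "has_angle (vector [-1, 0]) pi"
      unfolding has_angle_def by (auto intro!: exI[of _ 1])
    then show "list_all2 has_angle [vector [1, 0], vector [int c - k, 1], vector [-1, 0]]
        [0, pi / 2 - arctan (of_int (int c - k)), pi]"
      using has_angle_upper by (simp del: of_int_diff)
    show "list_all2 has_angle ?lows (map ?a [0..<Suc c])"
      unfolding list_all2_conv_all_nth using has_angle_lower by (simp del: upt_Suc of_int_add of_int_diff)
  qed
  have b: "- (pi / 2) < arctan t" "arctan t < pi / 2" for t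
    using arctan_bounded by auto
  have low: "pi < ?a n" "?a n < 2 * pi" for n
    using b[of "of_int (k - int c + int n)"] by simp_all
  have "sorted_wrt (<) (map ?a [0..<Suc c])"
    unfolding sorted_wrt_iff_nth_less by (simp add: arctan_less_iff del: upt_Suc)
  moreover have "\<forall>t\<in>set (map ?a [0..<Suc c]). pi < t"
    using low by (auto simp del: upt_Suc)
  ultimately have sorted: "sorted_wrt (<) ?\<theta>"
    using b[of "of_int (int c - k)"] pi_gt_zero by (auto simp del: upt_Suc intro: less_trans)
  have "last ?\<theta> < hd ?\<theta> + 2 * pi"
    using low(2)[of c] by simp
  then have ccw: "counterclockwise_once (map fst (normal_form c k))"
    unfolding counterclockwise_once_def using angles sorted by blast
  have "closed_path_ok (normal_form c k)"
    unfolding normal_form_def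
    by (simp add: path_ok_append path_ok_fake_run start_fake_run strict_corner_simps det_cols_eq)
  then have corners: "\<forall>i<length (normal_form c k). corner_ok (snd (normal_form c k ! i))
     (fst (normal_form c k ! i)) (fst (normal_form c k ! (Suc i mod length (normal_form c k))))"
    unfolding closed_path_ok_iff_nth strict_corner_def by blast
  have "\<forall>v\<in>set (map fst (normal_form c k)). primitive v"
    unfolding vs by (auto simp: primitive_def)
  then have "\<forall>i<length (normal_form c k). primitive (fst (normal_form c k ! i))"
    by (simp add: all_set_conv_all_nth)
  then show ?thesis
    unfolding semitoric_fan_def using ccw corners by (simp add: normal_form_def)
qed

theorem theorem1p1:
  fixes d c :: nat and F :: labelled_vectors
  assumes "d \<ge> 3"
    and "semitoric_fan F"
    and "length F = d"
    and "defect F = c"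
  shows "\<exists>G. fan_transformation\<^sup>*\<^sup>* F G \<and> semitoric_fan G \<and> G'_equivalent G (standard_fan c)"
proof -
  obtain k where k: "leads_to F (normal_form c k)"
    using leads_to_normal_form assms by blast
  \<comment> \<open>If no transformation was used, the given fan itself is a rotation of the normal form.\<close>
  from leads_to_cases[OF k] show ?thesis
  proof
    assume "fan_transformation\<^sup>*\<^sup>* F (normal_form c k)"
    then show ?thesis using normal_form_fan normal_form_equivalent by blast
  next
    assume "cyclic_relabelling F (normal_form c k)"
    then have "G'_equivalent F (standard_fan c)"
      using normal_form_equivalent[of c k] cyclic_relabelling_trans
      unfolding G'_equivalent_def cyclic_relabelling_def act_def
      by (metis rotate_map rotate_rotate)
    then show ?thesis using assms(2) by blast
  qed
qed

end
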